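(* Let $I,J\subset\mathbb{R}$ be open intervals, let $u:I\to\mathbb{R}$ and $v:J\to\mathbb{R}$ be smooth functions, and let the curves $\gamma_1$ and $\gamma_2$ in the Heisenberg group $\mathcal{H}_3$ be given by $\gamma_1(x)=(x,0,u(x))$, $x\in I$, and $\gamma_2(y)=(0,y,v(y))$, $y\in J$. The translation surface $S=\gamma_1*\gamma_2=\{\gamma_1(x)*\gamma_2(y): x\in I,\ y\in J\}$ is a non-parametric surface given by $(x,y,f(x,y))$, $(x,y)\in I\times J$, where $$f(x,y)=\frac{xy}{2}+u(x)+v(y).$$ Suppose that $S$ is flat, i.e. its intrinsic (Gauss) curvature $K$ vanishes identically. Then the determinant of the Gauss map of $S$ is zero and, up to a vertical translation (that is, up to adding a constant to $f$), $$f(x,y)=\frac{xy}{2}+Ax+\frac{(A+y)\sqrt{C(A+y)^2-1}}{2}+\frac{\ln\left|\sqrt{C(A+y)^2-1}-\sqrt{C}\,(A+y)\right|}{2\sqrt{C}},$$ where $A\in\mathbb{R}$ and $C>0$ are constants, with $C(A+y)^2\ge 1$ for all $y\in J$ so that the square root is real.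
   Context: The Heisenberg group $\mathcal{H}_3$ is $\mathbb{R}^3$ with the group law $$(a,b,c)*(x,y,z)=\left(a+x,\;b+y,\;c+z+\frac{ay-bx}{2}\right),$$ endowed with the left-invariant Riemannian metric $$ds^2=dx^2+dy^2+\left(\tfrac12 y\,dx-\tfrac12 x\,dy+dz\right)^2 .$$ A non-parametric surface is a surface that is the graph $S=\{(x,y,f(x,y))\}\subset\mathcal{H}_3$ of a smooth function $f$ on an open set $\Omega\subset\mathbb{R}^2$; it carries the metric induced from $ds^2$. In the coordinates $(x,y)$, with $p=f_x+\frac y2$ and $q=f_y-\frac x2$, its first fundamental form is $(1+p^2)\,dx^2+2pq\,dx\,dy+(1+q^2)\,dy^2$. The intrinsic (Gauss) curvature $K$ of $S$ is the Gaussian curvature of this Riemannian metric. $S$ is called flat if $K\equiv 0$. The Gauss map of $S$ is obtained by left-translating the unit normal of $S$ to the identity, giving a map into the unit upper hemisphere of the Lie algebra. Composing with the central projection $(x,y,z)\mapsto(x/z,y/z,1)$ onto the plane $z=1$, it is expressed in coordinates as $$\phi(x,y)=\left(-\left(f_x+\tfrac y2\right),\,-\left(f_y-\tfrac x2\right)\right).$$ The determinant of the Gauss map at $(x,y)$ is defined as $\det d\phi_{(x,y)}=f_{xx}f_{yy}-f_{xy}^2+\frac14$.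
   Formalization: The square root in both places of the formula may carry one global sign ±1 (the formula as displayed covers only increasing v; e.g. u=0, v'=-√(y²-1) on (1,2) is flat but not of that form); the intervals are nonempty. *)

theory Defs
  imports "HOL-Analysis.Analysis"
begin

section \<open>The Heisenberg group\<close>

type_synonym point3 = "real \<times> real \<times> real"

fun heis_mult :: "point3 \<Rightarrow> point3 \<Rightarrow> point3" where
  "heis_mult (a, b, c) (x, y, z) = (a + x, b + y, c + z + (a * y - b * x) / 2)"

text \<open>The metric as a bilinear form on tangent vectors (in the coordinate basis) at a point.\<close>

fun heis_metric :: "point3 \<Rightarrow> point3 \<Rightarrow> point3 \<Rightarrow> real" where
  "heis_metric (x, y, z) (a1, a2, a3) (b1, b2, b3) =
     a1 * b1 + a2 * b2 + (y * a1 / 2 - x * a2 / 2 + a3) * (y * b1 / 2 - x * b2 / 2 + b3)"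

definition translation_surface ::
    "(real \<Rightarrow> point3) \<Rightarrow> real set \<Rightarrow> (real \<Rightarrow> point3) \<Rightarrow> real set \<Rightarrow> point3 set" where
  "translation_surface \<gamma>\<^sub>1 I \<gamma>\<^sub>2 J = {heis_mult (\<gamma>\<^sub>1 x) (\<gamma>\<^sub>2 y) | x y. x \<in> I \<and> y \<in> J}"


section \<open>Partial derivatives and smoothness\<close>

definition pd :: "2 \<Rightarrow> (real \<times> real \<Rightarrow> real) \<Rightarrow> real \<times> real \<Rightarrow> real" where
  "pd i h = (\<lambda>(x, y). if i = 1 then deriv (\<lambda>t. h (t, y)) x else deriv (\<lambda>t. h (x, t)) y)"

text \<open>Both smoothness predicates are meant for open domains only; there the iterated
  derivatives do not depend on the values of the function outside the domain.\<close>

definition smooth_curve_on :: "real set \<Rightarrow> (real \<Rightarrow> real) \<Rightarrow> bool" where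
  "smooth_curve_on I u \<longleftrightarrow> (\<forall>n. (deriv ^^ n) u differentiable_on I)"

definition smooth_plane_on :: "(real \<times> real) set \<Rightarrow> (real \<times> real \<Rightarrow> real) \<Rightarrow> bool" where
  "smooth_plane_on \<Omega> f \<longleftrightarrow> (\<forall>is. foldr pd is f differentiable_on \<Omega>)"


section \<open>Gaussian curvature of a Riemannian metric on a plane domain\<close>

type_synonym metric2 = "real \<times> real \<Rightarrow> real ^ 2 ^ 2"

text \<open>\<open>christoffel g k i j\<close> is $\Gamma^k_{ij}$ of the Levi-Civita connection, and
  \<open>riemann g l i j k\<close> is the $l$-th component of $R(\partial_i, \partial_j)\partial_k$ with
  $R(X,Y) = [\nabla_X, \nabla_Y] - \nabla_{[X,Y]}$.\<close>

definition christoffel :: "metric2 \<Rightarrow> 2 \<Rightarrow> 2 \<Rightarrow> 2 \<Rightarrow> real \<times> real \<Rightarrow> real" where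
  "christoffel g k i j z =
     (\<Sum>l\<in>UNIV. matrix_inv (g z) $ k $ l *
        (pd i (\<lambda>w. g w $ j $ l) z + pd j (\<lambda>w. g w $ i $ l) z - pd l (\<lambda>w. g w $ i $ j) z)) / 2"

definition riemann :: "metric2 \<Rightarrow> 2 \<Rightarrow> 2 \<Rightarrow> 2 \<Rightarrow> 2 \<Rightarrow> real \<times> real \<Rightarrow> real" where
  "riemann g l i j k z =
     pd i (christoffel g l j k) z - pd j (christoffel g l i k) z +
     (\<Sum>m\<in>UNIV. christoffel g l i m z * christoffel g m j k z
               - christoffel g l j m z * christoffel g m i k z)"

text \<open>$K = \langle R(\partial_1,\partial_2)\partial_2, \partial_1\rangle / \det g$,
  normalised so that round spheres have positive curvature.\<close>

definition gauss_curvature :: "metric2 \<Rightarrow> real \<times> real \<Rightarrow> real" where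
  "gauss_curvature g z = (\<Sum>l\<in>UNIV. g z $ 1 $ l * riemann g l 1 2 2 z) / det (g z)"


section \<open>Non-parametric surfaces\<close>

definition graph_point :: "(real \<times> real \<Rightarrow> real) \<Rightarrow> real \<times> real \<Rightarrow> point3" where
  "graph_point f = (\<lambda>(x, y). (x, y, f (x, y)))"

definition nonparametric_surface ::
    "point3 set \<Rightarrow> (real \<times> real) set \<Rightarrow> (real \<times> real \<Rightarrow> real) \<Rightarrow> bool" where
  "nonparametric_surface S \<Omega> f \<longleftrightarrow> open \<Omega> \<and> smooth_plane_on \<Omega> f \<and> S = graph_point f ` \<Omega>"

definition graph_tangent :: "(real \<times> real \<Rightarrow> real) \<Rightarrow> 2 \<Rightarrow> real \<times> real \<Rightarrow> point3" where
  "graph_tangent f i z = (if i = 1 then (1, 0, pd 1 f z) else (0, 1, pd 2 f z))"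

text \<open>The first fundamental form: the pullback of the Heisenberg metric to the \<open>(x, y)\<close> domain.\<close>

definition first_fundamental_form :: "(real \<times> real \<Rightarrow> real) \<Rightarrow> metric2" where
  "first_fundamental_form f z =
     (\<chi> i j. heis_metric (graph_point f z) (graph_tangent f i z) (graph_tangent f j z))"

definition flat_graph :: "(real \<times> real) set \<Rightarrow> (real \<times> real \<Rightarrow> real) \<Rightarrow> bool" where
  "flat_graph \<Omega> f \<longleftrightarrow> (\<forall>z\<in>\<Omega>. gauss_curvature (first_fundamental_form f) z = 0)"

lemma first_fundamental_form_coords:
  fixes f :: "real \<times> real \<Rightarrow> real" and x y :: real
  defines "p \<equiv> pd 1 f (x, y) + y / 2" and "q \<equiv> pd 2 f (x, y) - x / 2"
  shows "first_fundamental_form f (x, y) = vector [vector [1 + p\<^sup>2, p * q], vector [p * q, 1 + q\<^sup>2]]"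
  unfolding first_fundamental_form_def p_def q_def
  by (simp add: vec_eq_iff forall_2 vector_2 graph_point_def graph_tangent_def
      power2_eq_square algebra_simps)


section \<open>The Gauss map\<close>

text \<open>The left-translated unit normal, centrally projected to the plane at height 1.\<close>

definition gauss_map :: "(real \<times> real \<Rightarrow> real) \<Rightarrow> real \<times> real \<Rightarrow> real \<times> real" where
  "gauss_map f = (\<lambda>(x, y). (- (pd 1 f (x, y) + y / 2), - (pd 2 f (x, y) - x / 2)))"

definition gauss_map_det :: "(real \<times> real \<Rightarrow> real) \<Rightarrow> real \<times> real \<Rightarrow> real" where
  "gauss_map_det f z = pd 1 (pd 1 f) z * pd 2 (pd 2 f) z - (pd 2 (pd 1 f) z)\<^sup>2 + 1 / 4"

lemma pd_eqI_1: "((\<lambda>t. h (t, y)) has_real_derivative d) (at x) \<Longrightarrow> pd 1 h (x, y) = d"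
  by (simp add: pd_def DERIV_imp_deriv)

lemma pd_eqI_2: "((\<lambda>t. h (x, t)) has_real_derivative d) (at y) \<Longrightarrow> pd 2 h (x, y) = d"
  by (simp add: pd_def DERIV_imp_deriv)

lemma plane_differentiable_slices:
  assumes "(h :: real \<times> real \<Rightarrow> real) differentiable (at (x, y))"
  shows "((\<lambda>t. h (t, y)) has_real_derivative pd 1 h (x, y)) (at x)"
    and "((\<lambda>t. h (x, t)) has_real_derivative pd 2 h (x, y)) (at y)"
proof -
  have "(\<lambda>t. h (t, y)) differentiable (at x)"
    using differentiable_chain_at[of "\<lambda>t. (t, y)" x h] assms by (simp add: o_def)
  then show "((\<lambda>t. h (t, y)) has_real_derivative pd 1 h (x, y)) (at x)"
    by (simp add: pd_def DERIV_deriv_iff_real_differentiable)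
  have "(\<lambda>t. h (x, t)) differentiable (at y)"
    using differentiable_chain_at[of "\<lambda>t. (x, t)" y h] assms by (simp add: o_def)
  then show "((\<lambda>t. h (x, t)) has_real_derivative pd 2 h (x, y)) (at y)"
    by (simp add: pd_def DERIV_deriv_iff_real_differentiable)
qed

text \<open>\<open>gauss_map_det\<close> is the Jacobian determinant of \<open>gauss_map\<close>, once mixed partials commute.\<close>

lemma gauss_map_det_eq_jacobian:
  assumes d1: "pd 1 f differentiable (at z)" and d2: "pd 2 f differentiable (at z)"
    and sym: "pd 1 (pd 2 f) z = pd 2 (pd 1 f) z"
  shows "gauss_map_det f z =
    pd 1 (fst \<circ> gauss_map f) z * pd 2 (snd \<circ> gauss_map f) z
    - pd 2 (fst \<circ> gauss_map f) z * pd 1 (snd \<circ> gauss_map f) z"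
proof -
  obtain x y where z: "z = (x, y)" by (cases z)
  note D = plane_differentiable_slices[OF d1[unfolded z]] plane_differentiable_slices[OF d2[unfolded z]]
  have "pd 1 (fst \<circ> gauss_map f) z = - pd 1 (pd 1 f) z"
    unfolding z by (rule pd_eqI_1) (auto simp: gauss_map_def intro!: derivative_eq_intros D)
  moreover have "pd 2 (fst \<circ> gauss_map f) z = - (pd 2 (pd 1 f) z + 1 / 2)"
    unfolding z by (rule pd_eqI_2) (auto simp: gauss_map_def intro!: derivative_eq_intros D)
  moreover have "pd 1 (snd \<circ> gauss_map f) z = - (pd 1 (pd 2 f) z - 1 / 2)"
    unfolding z by (rule pd_eqI_1) (auto simp: gauss_map_def intro!: derivative_eq_intros D)
  moreover have "pd 2 (snd \<circ> gauss_map f) z = - pd 2 (pd 2 f) z"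
    unfolding z by (rule pd_eqI_2) (auto simp: gauss_map_def intro!: derivative_eq_intros D)
  ultimately show ?thesis
    unfolding gauss_map_det_def sym by (simp only:) (simp add: power2_eq_square algebra_simps)
qed

end

theory Submission
  imports Defs
begin

text \<open>
  With $p = y + u'(x)$, $q = v'(y)$ and $W = 1 + p^2 + q^2$, the Gauss curvature of the translation
  surface satisfies
  $K W^2 = u'' v'' - 1 - q^2 + p q (v'' - u'')$.
  For fixed $y$, the equation $K = 0$ is affine in $u'$, $u''$ and $u' u''$.
  If $u''$ were nonzero somewhere, $u'$ would take infinitely many values; eliminating $u''$
  between two values of $y$ then gives a quadratic polynomial in $u'$ with infinitely many zeros,
  and comparing coefficients leads to a contradiction. Hence $u'' = 0$ and $u' = A$ is constant,
  so that $(A + y) q q' = 1 + q^2$. This makes $(1 + q^2) / (A + y)^2$ a constant $C > 0$ and $q$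
  free of zeros, and $v$ is an explicit primitive of $\pm\sqrt{C (A + y)^2 - 1}$.
\<close>

section \<open>Matrix inverses, smoothness and partial derivatives on open rectangles\<close>

lemma matrix_inv_2x2:
  fixes a b c d :: real
  assumes "a * d - b * c \<noteq> 0"
  shows "matrix_inv (vector [vector [a, b], vector [c, d]] :: real ^ 2 ^ 2) =
    vector [vector [d / (a * d - b * c), - b / (a * d - b * c)],
            vector [- c / (a * d - b * c), a / (a * d - b * c)]]"
    (is "matrix_inv ?A = ?B")
proof -
  have "?A ** ?B = mat 1"
    using assms
    by (simp add: matrix_matrix_mult_def vec_eq_iff forall_2 sum_2 mat_def
        add_divide_distrib[symmetric] diff_divide_distrib[symmetric] mult.commute)
  then have AB: "?A ** ?B = mat 1" and BA: "?B ** ?A = mat 1"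
    by (simp_all add: matrix_left_right_inverse)
  \<comment> \<open>\<open>matrix_inv\<close> is a Hilbert choice, so it is known to invert
    \<open>?A\<close> only once some two-sided inverse is exhibited. Multiplying by
    \<open>?B\<close> on the left then identifies it.\<close>
  then have "?A ** matrix_inv ?A = mat 1"
    unfolding matrix_inv_def by (metis (mono_tags, lifting) someI_ex)
  then have "?B ** (?A ** matrix_inv ?A) = ?B" by simp
  then show ?thesis
    by (simp only: matrix_mul_assoc BA matrix_mul_lid)
qed

lemma smooth_curve_on_deriv: "smooth_curve_on I u \<Longrightarrow> smooth_curve_on I (deriv u)"
  unfolding smooth_curve_on_def by (metis comp_apply funpow_Suc_right)

lemma smooth_curve_on_has_derivative:
  assumes "smooth_curve_on I u" "open I" "x \<in> I"
  shows "(u has_real_derivative deriv u x) (at x)"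
proof -
  have "u differentiable_on I"
    using assms(1) unfolding smooth_curve_on_def by (metis funpow_0)
  then show ?thesis
    using assms(2,3) by (simp add: differentiable_on_eq_differentiable_at DERIV_deriv_iff_real_differentiable)
qed

text \<open>Differentiating \<open>k * x * y\<close> in one variable leaves a linear function of the
  other, whose smoothness is supplied here.\<close>

lemma smooth_curve_on_linear: "smooth_curve_on I (\<lambda>x. k * x)"
proof -
  have 1: "deriv (\<lambda>x. k * x) = (\<lambda>_. k)"
    by (rule ext, rule DERIV_imp_deriv) (auto intro!: derivative_eq_intros)
  have "\<exists>m. (deriv ^^ Suc n) (\<lambda>x. k * x) = (\<lambda>_. m)" for n
    by (induction n) (use 1 in auto)
  then have "(deriv ^^ Suc n) (\<lambda>x. k * x) differentiable_on I" for n
    by (metis differentiable_on_const)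
  then have "(deriv ^^ n) (\<lambda>x. k * x) differentiable_on I" for n
    by (cases n) (simp_all add: differentiable_on_mult differentiable_on_const differentiable_on_ident)
  then show ?thesis unfolding smooth_curve_on_def by blast
qed

text \<open>A partial derivative sees only values on a short slice, which stays inside the open
  rectangle. Closed forms known only on \<open>I \<times> J\<close> may therefore be differentiated
  in place of the original functions.\<close>

lemma pd_cong_open:
  assumes "open I" "open J" "z \<in> I \<times> J" "\<And>w. w \<in> I \<times> J \<Longrightarrow> h w = h' w"
  shows "pd i h z = pd i h' z"
proof -
  obtain x y where z: "z = (x, y)" "x \<in> I" "y \<in> J" using assms(3) by blast
  have "\<forall>\<^sub>F t in nhds x. h (t, y) = h' (t, y)"
    using eventually_nhds_in_open[OF assms(1) z(2)] by eventually_elim (simp add: assms(4) z)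
  moreover have "\<forall>\<^sub>F t in nhds y. h (x, t) = h' (x, t)"
    using eventually_nhds_in_open[OF assms(2) z(3)] by eventually_elim (simp add: assms(4) z)
  ultimately show ?thesis
    unfolding pd_def z by (auto intro!: deriv_cong_ev)
qed

lemma smooth_plane_on_translation_graph:
  assumes "open I" "open J" "smooth_curve_on I r" "smooth_curve_on J s"
    and "\<And>x y. x \<in> I \<Longrightarrow> y \<in> J \<Longrightarrow> h (x, y) = k * x * y + r x + s y"
  shows "smooth_plane_on (I \<times> J) h"
proof -
  \<comment> \<open>Functions of the form \<open>k x y + r(x) + s(y)\<close> are closed under both partial derivatives.\<close>
  have repr: "\<exists>k r s. smooth_curve_on I r \<and> smooth_curve_on J s \<and>
      (\<forall>x\<in>I. \<forall>y\<in>J. foldr pd is h (x, y) = k * x * y + r x + s y)" for "is"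
  proof (induction "is")
    case Nil
    then show ?case using assms by auto
  next
    case (Cons i "is")
    then obtain k r s where r: "smooth_curve_on I r" and s: "smooth_curve_on J s"
      and eq: "\<forall>x\<in>I. \<forall>y\<in>J. foldr pd is h (x, y) = k * x * y + r x + s y" by blast
    let ?h = "\<lambda>(x, y). k * x * y + r x + s y"
    have cong: "pd i (foldr pd is h) z = pd i ?h z" if "z \<in> I \<times> J" for z
      using assms(1,2) that eq by (intro pd_cong_open[of I J]) auto
    consider "i = 1" | "i = 2" using exhaust_2 by blast
    then show ?case
    proof cases
      case 1
      \<comment> \<open>The mixed coefficient drops to 0 and \<open>k * y\<close> becomes the new
        function of \<open>y\<close>; the zero term is kept to match the shape of the induction
        claim.\<close>
      have "pd 1 ?h (x, y) = 0 * x * y + deriv r x + k * y" if "x \<in> I" for x y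
        by (rule pd_eqI_1)
          (auto intro!: derivative_eq_intros smooth_curve_on_has_derivative[OF r assms(1) that])
      then show ?thesis
        using cong smooth_curve_on_deriv[OF r] smooth_curve_on_linear 1
        by (intro exI[of _ 0] exI[of _ "deriv r"] exI[of _ "\<lambda>y. k * y"]) auto
    next
      case 2
      have "pd 2 ?h (x, y) = 0 * x * y + k * x + deriv s y" if "y \<in> J" for x y
        by (rule pd_eqI_2)
          (auto intro!: derivative_eq_intros smooth_curve_on_has_derivative[OF s assms(2) that])
      then show ?thesis
        using cong smooth_curve_on_deriv[OF s] smooth_curve_on_linear 2
        by (intro exI[of _ 0] exI[of _ "\<lambda>x. k * x"] exI[of _ "deriv s"]) auto
    qed
  qed
  show ?thesis
    unfolding smooth_plane_on_def
  proof
    fix "is"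
    obtain k r s where r: "smooth_curve_on I r" and s: "smooth_curve_on J s"
      and eq: "\<forall>x\<in>I. \<forall>y\<in>J. foldr pd is h (x, y) = k * x * y + r x + s y" using repr by blast
    \<comment> \<open>Smoothness on the plane asks for total differentiability of each iterated
      partial derivative, so existence of the partials alone does not suffice.\<close>
    have D: "((\<lambda>z. k * fst z * snd z + r (fst z) + s (snd z)) has_derivative
        (\<lambda>w. k * x * snd w + k * fst w * y + deriv r x * fst w + deriv s y * snd w)) (at (x, y))"
      if "x \<in> I" "y \<in> J" for x y
    proof -
      have R: "((\<lambda>z. r (fst z)) has_derivative (\<lambda>w. fst w * deriv r x)) (at (x, y))"
        using smooth_curve_on_has_derivative[OF r assms(1) that(1)]
        by (intro DERIV_compose_FDERIV) (auto intro!: derivative_eq_intros)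
      have S: "((\<lambda>z. s (snd z)) has_derivative (\<lambda>w. snd w * deriv s y)) (at (x, y))"
        using smooth_curve_on_has_derivative[OF s assms(2) that(2)]
        by (intro DERIV_compose_FDERIV) (auto intro!: derivative_eq_intros)
      have K: "((\<lambda>z. k * fst z * snd z) has_derivative (\<lambda>w. k * x * snd w + k * fst w * y)) (at (x, y))"
        by (auto intro!: derivative_eq_intros)
      show ?thesis
        by (rule has_derivative_eq_rhs[OF has_derivative_add[OF has_derivative_add[OF K R] S]])
          (simp add: fun_eq_iff mult.commute)
    qed
    have "foldr pd is h differentiable (at (x, y))" if "x \<in> I" "y \<in> J" for x y
      by (rule differentiableI,
          rule has_derivative_transform_within_open[OF D[OF that] open_Times[OF assms(1,2)]])
        (use that eq in auto)
    then show "foldr pd is h differentiable_on (I \<times> J)"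
      using assms(1,2) by (auto simp: differentiable_on_eq_differentiable_at open_Times)
  qed
qed

section \<open>Quadratics with infinitely many zeros, and the primitive of the square root\<close>

lemma quadratic_zero_on_infinite:
  fixes a b c :: real
  assumes "infinite S" "\<And>w. w \<in> S \<Longrightarrow> a + b * w + c * w\<^sup>2 = 0"
  shows "a = 0 \<and> b = 0 \<and> c = 0"
proof -
  have "S \<subseteq> {w. poly [:a, b, c:] w = 0}"
    using assms(2) by (auto simp: power2_eq_square algebra_simps)
  then have "[:a, b, c:] = 0"
    using assms(1) poly_roots_finite finite_subset by blast
  then show ?thesis by simp
qed

lemma has_real_derivative_ln_abs:
  assumes "(x::real) \<noteq> 0"
  shows "((\<lambda>t. ln \<bar>t\<bar>) has_real_derivative 1 / x) (at x)"
proof -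
  \<comment> \<open>Squaring removes the absolute value. The identity extends to
    \<open>t = 0\<close> by the convention \<open>ln 0 = 0\<close>, so the two functions are equal
    everywhere.\<close>
  have "ln \<bar>t\<bar> = ln (t\<^sup>2) / 2" for t :: real
    using ln_realpow[of "\<bar>t\<bar>" 2] by (cases "t = 0") simp_all
  then have eq: "(\<lambda>t::real. ln \<bar>t\<bar>) = (\<lambda>t. ln (t\<^sup>2) / 2)" by blast
  have "((\<lambda>t. ln (t\<^sup>2) / 2) has_real_derivative 1 / x\<^sup>2 * (2 * x) / 2) (at x)"
    using assms by (intro DERIV_cdivide DERIV_chain2[OF DERIV_ln_divide]) (auto intro!: derivative_eq_intros)
  moreover have "1 / x\<^sup>2 * (2 * x) / 2 = 1 / x"
    using assms by (simp add: power2_eq_square)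
  ultimately show ?thesis
    unfolding eq by simp
qed

text \<open>With s = A + y and r = e sqrt(C s^2 - 1), one has r' = C s / r. The product term
  contributes (r + s r')/2 = r + 1/(2r), and the logarithm contributes -1/(2r). Only r^2 = C s^2 - 1
  enters, so both signs \<open>e\<close> are treated at once.\<close>

lemma has_real_derivative_translation_primitive:
  fixes A C e y :: real
  assumes "C > 0" "e \<in> {1, -1}" "C * (A + y)\<^sup>2 > 1"
  shows "((\<lambda>y. (A + y) * (e * sqrt (C * (A + y)\<^sup>2 - 1)) / 2
      + ln \<bar>e * sqrt (C * (A + y)\<^sup>2 - 1) - sqrt C * (A + y)\<bar> / (2 * sqrt C))
    has_real_derivative e * sqrt (C * (A + y)\<^sup>2 - 1)) (at y)"
proof -
  define s where "s = A + y"
  define r where "r = e * sqrt (C * s\<^sup>2 - 1)"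
  have e: "e * e = 1" using assms(2) by auto
  have pos: "C * s\<^sup>2 - 1 > 0" using assms(3) by (simp add: s_def)
  have r2: "r * r = C * s\<^sup>2 - 1"
    using e pos by (simp add: r_def mult.left_commute mult.assoc[symmetric])
  then have "r \<noteq> 0" using pos by auto
  have c2: "sqrt C * sqrt C = C" "sqrt C \<noteq> 0" using assms(1) by simp_all
  \<comment> \<open>The conjugate factors multiply to -1, so the argument of the logarithm never
    vanishes.\<close>
  have "(r - sqrt C * s) * (r + sqrt C * s) = r * r - sqrt C * sqrt C * s\<^sup>2"
    by (simp add: algebra_simps power2_eq_square)
  also have "\<dots> = -1" using r2 c2 by simp
  finally have d: "r - sqrt C * s \<noteq> 0" by auto
  have R: "((\<lambda>y. e * sqrt (C * (A + y)\<^sup>2 - 1)) has_real_derivative C * s / r) (at y)"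
  proof -
    have "((\<lambda>y. C * (A + y)\<^sup>2 - 1) has_real_derivative C * (2 * s)) (at y)"
      by (auto intro!: derivative_eq_intros simp: s_def)
    then have "((\<lambda>y. e * sqrt (C * (A + y)\<^sup>2 - 1)) has_real_derivative
        e * (inverse (sqrt (C * s\<^sup>2 - 1)) / 2 * (C * (2 * s)))) (at y)"
      using pos unfolding s_def by (intro DERIV_cmult DERIV_chain2[OF DERIV_real_sqrt])
    moreover have "e * (inverse (sqrt (C * s\<^sup>2 - 1)) / 2 * (C * (2 * s))) = C * s / r"
      using e pos assms(2) by (auto simp: r_def field_simps)
    ultimately show ?thesis by simp
  qed
  have S: "((\<lambda>y. A + y) has_real_derivative 1) (at y)"
    by (auto intro!: derivative_eq_intros)
  have L: "((\<lambda>y. ln \<bar>e * sqrt (C * (A + y)\<^sup>2 - 1) - sqrt C * (A + y)\<bar>) has_real_derivative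
      1 / (r - sqrt C * s) * (C * s / r - sqrt C)) (at y)"
  proof -
    have "((\<lambda>y. e * sqrt (C * (A + y)\<^sup>2 - 1) - sqrt C * (A + y)) has_real_derivative C * s / r - sqrt C) (at y)"
      using DERIV_diff[OF R DERIV_cmult[OF S, of "sqrt C"]] by simp
    then show ?thesis
      by (rule DERIV_chain2[where f = "\<lambda>t. ln \<bar>t\<bar>", rotated])
        (use has_real_derivative_ln_abs[OF d] in \<open>simp only: r_def s_def\<close>)
  qed
  have "C * s / r - sqrt C = - sqrt C / r * (r - sqrt C * s)"
    using \<open>r \<noteq> 0\<close> c2 by (simp add: field_simps)
  then have "1 / (r - sqrt C * s) * (C * s / r - sqrt C) / (2 * sqrt C) = - 1 / (2 * r)"
    using d \<open>r \<noteq> 0\<close> c2 by simp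
  moreover have "s * (C * s / r) = (r * r + 1) / r"
    using r2 by (simp add: power2_eq_square mult_ac)
  then have "(r + s * (C * s / r)) / 2 + - 1 / (2 * r) = r"
    using \<open>r \<noteq> 0\<close> by (simp add: field_simps)
  ultimately have eq: "(1 * r + (C * s / r) * s) / 2
      + 1 / (r - sqrt C * s) * (C * s / r - sqrt C) / (2 * sqrt C) = r"
    by (simp add: mult.commute)
  show ?thesis
    using DERIV_add[OF DERIV_cdivide[OF DERIV_mult[OF S R], of 2] DERIV_cdivide[OF L, of "2 * sqrt C"]]
    unfolding s_def[symmetric] r_def[symmetric] eq .
qed

section \<open>Curvature and Gauss map determinant of a translation graph\<close>

locale translation_graph =
  fixes I J :: "real set" and u u' u'' v v' v'' :: "real \<Rightarrow> real" and f :: "real \<times> real \<Rightarrow> real"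
  assumes I: "open I" "is_interval I" "I \<noteq> {}" and J: "open J" "is_interval J" "J \<noteq> {}"
    and u: "\<And>x. x \<in> I \<Longrightarrow> (u has_real_derivative u' x) (at x)"
           "\<And>x. x \<in> I \<Longrightarrow> (u' has_real_derivative u'' x) (at x)"
    and v: "\<And>y. y \<in> J \<Longrightarrow> (v has_real_derivative v' y) (at y)"
           "\<And>y. y \<in> J \<Longrightarrow> (v' has_real_derivative v'' y) (at y)"
    and f: "\<And>x y. f (x, y) = x * y / 2 + u x + v y"
begin

text \<open>This is f_x + y/2. Its companion f_y - x/2 is just \<open>v' y\<close>: the halves
  coming from xy/2 add up in the first and cancel in the second. \<open>W\<close> is the determinant
  of the first fundamental form.\<close>

abbreviation p where "p x y \<equiv> y + u' x"
abbreviation W where "W x y \<equiv> 1 + (p x y)\<^sup>2 + (v' y)\<^sup>2"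

lemma W_pos: "W x y > 0"
  by (simp add: add_pos_nonneg)

lemma pd_f:
  assumes "x \<in> I" "y \<in> J"
  shows "pd 1 f (x, y) = y / 2 + u' x" "pd 2 f (x, y) = x / 2 + v' y"
  by (rule pd_eqI_1 pd_eqI_2, auto simp: f assms intro!: derivative_eq_intros u v)+

text \<open>The mixed derivative f_xy is the constant 1/2, whose square cancels the 1/4 in the
  determinant.\<close>

lemma gauss_map_det_eq:
  assumes "x \<in> I" "y \<in> J"
  shows "gauss_map_det f (x, y) = u'' x * v'' y"
proof -
  have "pd 1 (pd 1 f) (x, y) = pd 1 (\<lambda>(x, y). y / 2 + u' x) (x, y)"
       "pd 2 (pd 1 f) (x, y) = pd 2 (\<lambda>(x, y). y / 2 + u' x) (x, y)"
       "pd 2 (pd 2 f) (x, y) = pd 2 (\<lambda>(x, y). x / 2 + v' y) (x, y)"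
    using assms by (intro pd_cong_open[OF I(1) J(1)]; auto simp: pd_f)+
  moreover have "pd 1 (\<lambda>(x, y). y / 2 + u' x) (x, y) = u'' x"
    by (rule pd_eqI_1) (auto intro!: derivative_eq_intros u assms)
  moreover have "pd 2 (\<lambda>(x, y). y / 2 + u' x) (x, y) = 1 / 2"
    by (rule pd_eqI_2) (auto intro!: derivative_eq_intros)
  moreover have "pd 2 (\<lambda>(x, y). x / 2 + v' y) (x, y) = v'' y"
    by (rule pd_eqI_2) (auto intro!: derivative_eq_intros v assms)
  ultimately show ?thesis
    unfolding gauss_map_det_def by (simp only:) (simp add: power2_eq_square)
qed

abbreviation g where "g \<equiv> first_fundamental_form f"

lemma first_fundamental_form_eq:
  assumes "x \<in> I" "y \<in> J"
  shows "g (x, y) = vector [vector [1 + (p x y)\<^sup>2, p x y * v' y], vector [p x y * v' y, 1 + (v' y)\<^sup>2]]"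
  using assms by (simp add: first_fundamental_form_coords pd_f algebra_simps)

lemma matrix_inv_g:
  assumes "x \<in> I" "y \<in> J"
  shows "matrix_inv (g (x, y)) =
    vector [vector [(1 + (v' y)\<^sup>2) / W x y, - (p x y * v' y) / W x y],
            vector [- (p x y * v' y) / W x y, (1 + (p x y)\<^sup>2) / W x y]]"
proof -
  have "(1 + (p x y)\<^sup>2) * (1 + (v' y)\<^sup>2) - (p x y * v' y) * (p x y * v' y) = W x y"
    by (simp add: power2_eq_square algebra_simps)
  then show ?thesis
    unfolding first_fundamental_form_eq[OF assms]
    using matrix_inv_2x2 W_pos by (metis less_irrefl)
qed

lemma pd_g:
  assumes "x \<in> I" "y \<in> J"
  shows "pd 1 (\<lambda>w. g w $ 1 $ 1) (x, y) = 2 * p x y * u'' x"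
    "pd 2 (\<lambda>w. g w $ 1 $ 1) (x, y) = 2 * p x y"
    "pd 1 (\<lambda>w. g w $ 1 $ 2) (x, y) = u'' x * v' y"
    "pd 1 (\<lambda>w. g w $ 2 $ 1) (x, y) = u'' x * v' y"
    "pd 2 (\<lambda>w. g w $ 1 $ 2) (x, y) = v' y + p x y * v'' y"
    "pd 2 (\<lambda>w. g w $ 2 $ 1) (x, y) = v' y + p x y * v'' y"
    "pd 1 (\<lambda>w. g w $ 2 $ 2) (x, y) = 0"
    "pd 2 (\<lambda>w. g w $ 2 $ 2) (x, y) = 2 * v' y * v'' y"
proof -
  have c: "pd i (\<lambda>w. g w $ j $ k) (x, y) = pd i (\<lambda>(x, y). vector [vector [1 + (p x y)\<^sup>2, p x y * v' y],
      vector [p x y * v' y, 1 + (v' y)\<^sup>2]] $ j $ k) (x, y)" for i and j k :: 2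
    using assms by (intro pd_cong_open[OF I(1) J(1)]) (auto simp: first_fundamental_form_eq)
  show "pd 1 (\<lambda>w. g w $ 1 $ 1) (x, y) = 2 * p x y * u'' x"
    "pd 2 (\<lambda>w. g w $ 1 $ 1) (x, y) = 2 * p x y"
    "pd 1 (\<lambda>w. g w $ 1 $ 2) (x, y) = u'' x * v' y"
    "pd 1 (\<lambda>w. g w $ 2 $ 1) (x, y) = u'' x * v' y"
    "pd 2 (\<lambda>w. g w $ 1 $ 2) (x, y) = v' y + p x y * v'' y"
    "pd 2 (\<lambda>w. g w $ 2 $ 1) (x, y) = v' y + p x y * v'' y"
    "pd 1 (\<lambda>w. g w $ 2 $ 2) (x, y) = 0"
    "pd 2 (\<lambda>w. g w $ 2 $ 2) (x, y) = 2 * v' y * v'' y"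
    unfolding c
    by (rule pd_eqI_1 pd_eqI_2, auto intro!: derivative_eq_intros u v assms simp: vector_2)+
qed

lemma christoffel_eq:
  assumes "x \<in> I" "y \<in> J"
  shows "christoffel g 1 1 1 (x, y) = (p x y * u'' x + (p x y)\<^sup>2 * v' y) / W x y"
    "christoffel g 2 1 1 (x, y) = (u'' x * v' y - p x y - p x y ^ 3) / W x y"
    "christoffel g 1 1 2 (x, y) = p x y * (1 + (v' y)\<^sup>2) / W x y"
    "christoffel g 1 2 1 (x, y) = p x y * (1 + (v' y)\<^sup>2) / W x y"
    "christoffel g 2 1 2 (x, y) = - ((p x y)\<^sup>2 * v' y) / W x y"
    "christoffel g 2 2 1 (x, y) = - ((p x y)\<^sup>2 * v' y) / W x y"
    "christoffel g 1 2 2 (x, y) = (v' y + v' y ^ 3 + p x y * v'' y) / W x y"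
    "christoffel g 2 2 2 (x, y) = (v' y * v'' y - p x y * (v' y)\<^sup>2) / W x y"
proof -
  \<comment> \<open>All entries of the inverse metric share the denominator \<open>W\<close>, so
    each Christoffel symbol reduces to a polynomial identity between numerators.\<close>
  have combine: "(k / w * s + l / w * t) / 2 = n / w" if "k * s + l * t = 2 * n" for k l n s t w :: real
    using that by (simp add: add_divide_distrib[symmetric])
  show "christoffel g 1 1 1 (x, y) = (p x y * u'' x + (p x y)\<^sup>2 * v' y) / W x y"
    unfolding christoffel_def sum_2 matrix_inv_g[OF assms] pd_g[OF assms] vector_2
    by (rule combine) algebra
  show "christoffel g 2 1 1 (x, y) = (u'' x * v' y - p x y - p x y ^ 3) / W x y"
    unfolding christoffel_def sum_2 matrix_inv_g[OF assms] pd_g[OF assms] vector_2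
    by (rule combine) algebra
  show "christoffel g 1 1 2 (x, y) = p x y * (1 + (v' y)\<^sup>2) / W x y"
    unfolding christoffel_def sum_2 matrix_inv_g[OF assms] pd_g[OF assms] vector_2
    by (rule combine) algebra
  show "christoffel g 1 2 1 (x, y) = p x y * (1 + (v' y)\<^sup>2) / W x y"
    unfolding christoffel_def sum_2 matrix_inv_g[OF assms] pd_g[OF assms] vector_2
    by (rule combine) algebra
  show "christoffel g 2 1 2 (x, y) = - ((p x y)\<^sup>2 * v' y) / W x y"
    unfolding christoffel_def sum_2 matrix_inv_g[OF assms] pd_g[OF assms] vector_2
    by (rule combine) algebra
  show "christoffel g 2 2 1 (x, y) = - ((p x y)\<^sup>2 * v' y) / W x y"
    unfolding christoffel_def sum_2 matrix_inv_g[OF assms] pd_g[OF assms] vector_2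
    by (rule combine) algebra
  show "christoffel g 1 2 2 (x, y) = (v' y + v' y ^ 3 + p x y * v'' y) / W x y"
    unfolding christoffel_def sum_2 matrix_inv_g[OF assms] pd_g[OF assms] vector_2
    by (rule combine) algebra
  show "christoffel g 2 2 2 (x, y) = (v' y * v'' y - p x y * (v' y)\<^sup>2) / W x y"
    unfolding christoffel_def sum_2 matrix_inv_g[OF assms] pd_g[OF assms] vector_2
    by (rule combine) algebra
qed

lemma gauss_curvature_eq:
  assumes "x \<in> I" "y \<in> J"
  shows "gauss_curvature g (x, y) =
    (u'' x * v'' y - 1 - (v' y)\<^sup>2 + p x y * v' y * (v'' y - u'' x)) / (W x y)\<^sup>2"
proof -
  note [simp] = less_imp_neq[OF W_pos, symmetric]
  \<comment> \<open>No third derivatives arise: the symbols with lower indices 2, 2 contain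
    \<open>v''\<close> but are differentiated in \<open>x\<close>, and those with lower indices 1, 2
    contain only first derivatives of \<open>u\<close> and \<open>v\<close>.\<close>
  have "pd 1 (christoffel g 1 2 2) (x, y) =
      pd 1 (\<lambda>(x, y). (v' y + v' y ^ 3 + p x y * v'' y) / W x y) (x, y)"
    "pd 1 (christoffel g 2 2 2) (x, y) =
      pd 1 (\<lambda>(x, y). (v' y * v'' y - p x y * (v' y)\<^sup>2) / W x y) (x, y)"
    "pd 2 (christoffel g 1 1 2) (x, y) =
      pd 2 (\<lambda>(x, y). p x y * (1 + (v' y)\<^sup>2) / W x y) (x, y)"
    "pd 2 (christoffel g 2 1 2) (x, y) =
      pd 2 (\<lambda>(x, y). - ((p x y)\<^sup>2 * v' y) / W x y) (x, y)"
    using assms by (intro pd_cong_open[OF I(1) J(1)]; auto simp: christoffel_eq)+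
  moreover have "pd 1 (\<lambda>(x, y). (v' y + v' y ^ 3 + p x y * v'' y) / W x y) (x, y) =
      (u'' x * v'' y * W x y - (v' y + v' y ^ 3 + p x y * v'' y) * (2 * p x y * u'' x)) / (W x y)\<^sup>2"
    by (rule pd_eqI_1)
       (auto intro!: derivative_eq_intros u v assms simp: power2_eq_square[of "W x y"])
  moreover have "pd 1 (\<lambda>(x, y). (v' y * v'' y - p x y * (v' y)\<^sup>2) / W x y) (x, y) =
      (- u'' x * (v' y)\<^sup>2 * W x y - (v' y * v'' y - p x y * (v' y)\<^sup>2) * (2 * p x y * u'' x)) / (W x y)\<^sup>2"
    by (rule pd_eqI_1)
       (auto intro!: derivative_eq_intros u v assms simp: power2_eq_square[of "W x y"])
  moreover have "pd 2 (\<lambda>(x, y). p x y * (1 + (v' y)\<^sup>2) / W x y) (x, y) =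
      ((1 + (v' y)\<^sup>2 + p x y * (2 * v' y * v'' y)) * W x y
        - p x y * (1 + (v' y)\<^sup>2) * (2 * p x y + 2 * v' y * v'' y)) / (W x y)\<^sup>2"
    by (rule pd_eqI_2)
       (auto intro!: derivative_eq_intros u v assms simp: power2_eq_square[of "W x y"], simp add: algebra_simps)
  moreover have "pd 2 (\<lambda>(x, y). - ((p x y)\<^sup>2 * v' y) / W x y) (x, y) =
      (- (2 * p x y * v' y + (p x y)\<^sup>2 * v'' y) * W x y
        + (p x y)\<^sup>2 * v' y * (2 * p x y + 2 * v' y * v'' y)) / (W x y)\<^sup>2"
    by (rule pd_eqI_2)
       (auto intro!: derivative_eq_intros u v assms simp: power2_eq_square[of "W x y"], simp add: minus_divide_left algebra_simps del: divide_minus_left)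
  ultimately have pd_eqs:
    "pd 1 (christoffel g 1 2 2) (x, y) =
      (u'' x * v'' y * W x y - (v' y + v' y ^ 3 + p x y * v'' y) * (2 * p x y * u'' x)) / (W x y)\<^sup>2"
    "pd 1 (christoffel g 2 2 2) (x, y) =
      (- u'' x * (v' y)\<^sup>2 * W x y - (v' y * v'' y - p x y * (v' y)\<^sup>2) * (2 * p x y * u'' x)) / (W x y)\<^sup>2"
    "pd 2 (christoffel g 1 1 2) (x, y) =
      ((1 + (v' y)\<^sup>2 + p x y * (2 * v' y * v'' y)) * W x y
        - p x y * (1 + (v' y)\<^sup>2) * (2 * p x y + 2 * v' y * v'' y)) / (W x y)\<^sup>2"
    "pd 2 (christoffel g 2 1 2) (x, y) =
      (- (2 * p x y * v' y + (p x y)\<^sup>2 * v'' y) * W x y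
        + (p x y)\<^sup>2 * v' y * (2 * p x y + 2 * v' y * v'' y)) / (W x y)\<^sup>2"
    by simp_all
  have det: "det (g (x, y)) = W x y"
    unfolding first_fundamental_form_eq[OF assms] det_2 vector_2
    by (simp add: power2_eq_square algebra_simps)
  \<comment> \<open>Treating the function values as independent variables leaves polynomial algebra;
    \<open>N1\<close> and \<open>N2\<close> are the numerators over \<open>w\<^sup>2\<close> of the
    two components of R(d_1, d_2) d_2.\<close>
  define P Q a b w where "P = p x y" and "Q = v' y" and "a = u'' x" and "b = v'' y" and "w = W x y"
  have w: "w = 1 + P\<^sup>2 + Q\<^sup>2" and "w \<noteq> 0"
    unfolding w_def P_def Q_def by simp_all
  define N1 where "N1 = a * b * w - (Q + Q ^ 3 + P * b) * (2 * P * a)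
      - ((1 + Q\<^sup>2 + P * (2 * Q * b)) * w - P * (1 + Q\<^sup>2) * (2 * P + 2 * Q * b))
      + ((P * a + P\<^sup>2 * Q) * (Q + Q ^ 3 + P * b) - P * (1 + Q\<^sup>2) * (P * (1 + Q\<^sup>2))
        + (P * (1 + Q\<^sup>2) * (Q * b - P * Q\<^sup>2) - (Q + Q ^ 3 + P * b) * (- (P\<^sup>2 * Q))))"
  define N2 where "N2 = - a * Q\<^sup>2 * w - (Q * b - P * Q\<^sup>2) * (2 * P * a)
      - (- (2 * P * Q + P\<^sup>2 * b) * w + P\<^sup>2 * Q * (2 * P + 2 * Q * b))
      + ((a * Q - P - P ^ 3) * (Q + Q ^ 3 + P * b) - (- (P\<^sup>2 * Q)) * (P * (1 + Q\<^sup>2))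
        + ((- (P\<^sup>2 * Q)) * (Q * b - P * Q\<^sup>2) - (Q * b - P * Q\<^sup>2) * (- (P\<^sup>2 * Q))))"
  have combine: "k / w\<^sup>2 - l / w\<^sup>2 + (a1 / w * (b1 / w) - a2 / w * (b2 / w) + (a3 / w * (b3 / w) - a4 / w * (b4 / w)))
      = (k - l + (a1 * b1 - a2 * b2 + (a3 * b3 - a4 * b4))) / w\<^sup>2" for k l a1 b1 a2 b2 a3 b3 a4 b4
    by (simp add: power2_eq_square add_divide_distrib diff_divide_distrib)
  have R: "riemann g 1 1 2 2 (x, y) = N1 / w\<^sup>2" "riemann g 2 1 2 2 (x, y) = N2 / w\<^sup>2"
    unfolding riemann_def sum_2 pd_eqs christoffel_eq[OF assms] w_def[symmetric]
    unfolding P_def[symmetric] Q_def[symmetric] a_def[symmetric] b_def[symmetric] N1_def N2_def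
    by (rule combine)+
  \<comment> \<open>Lowering the index with the first row of the metric produces a factor
    \<open>w\<close>, which cancels the division by the determinant.\<close>
  have "(1 + P\<^sup>2) * N1 + P * Q * N2 = (a * b - 1 - Q\<^sup>2 + P * Q * (b - a)) * w"
    unfolding N1_def N2_def w by algebra
  moreover have "gauss_curvature g (x, y) = ((1 + P\<^sup>2) * N1 + P * Q * N2) / w\<^sup>2 / w"
    unfolding gauss_curvature_def det
    unfolding sum_2 R first_fundamental_form_eq[OF assms] vector_2 w_def[symmetric]
    unfolding P_def[symmetric] Q_def[symmetric]
    by (simp add: add_divide_distrib)
  ultimately show ?thesis
    using \<open>w \<noteq> 0\<close>
    unfolding w_def[symmetric]
    unfolding P_def[symmetric] Q_def[symmetric] a_def[symmetric] b_def[symmetric]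
    by (simp add: power2_eq_square[of w])
qed

end

section \<open>Solving the flatness equation\<close>

locale flat_translation_graph = translation_graph +
  assumes flat: "flat_graph (I \<times> J) f"
begin

lemma flat_eq:
  assumes "x \<in> I" "y \<in> J"
  shows "u'' x * v'' y - 1 - (v' y)\<^sup>2 + (y + u' x) * v' y * (v'' y - u'' x) = 0"
  using flat W_pos[where x = x and y = y] gauss_curvature_eq[OF assms] assms
  unfolding flat_graph_def by auto

text \<open>The image of an interval under the continuous \<open>u'\<close> is connected, and a
  finite connected set is a point; \<open>u'\<close> would then be constant, contradicting
  \<open>u'' x \<noteq> 0\<close>.\<close>

lemma infinite_range_u':
  assumes "x \<in> I" "u'' x \<noteq> 0"
  shows "infinite (u' ` I)"
proof
  assume fin: "finite (u' ` I)"
  have "continuous_on I u'"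
    using u(2) DERIV_continuous_on has_field_derivative_at_within by blast
  then have "connected (u' ` I)"
    using I(2) connected_continuous_image is_interval_connected by blast
  then obtain m where m: "u' ` I = {m}"
    using fin I(3) connected_finite_iff_sing by blast
  have "(u' has_real_derivative 0) (at x)"
    by (rule has_field_derivative_transform_within_open[where f = "\<lambda>_. m", OF DERIV_const I(1) assms(1)])
      (use m in auto)
  then show False
    using u(2)[OF assms(1)] assms(2) DERIV_unique by blast
qed

lemma derivative_of_const_on_J:
  assumes "(h has_real_derivative d) (at y)" "\<And>t. t \<in> J \<Longrightarrow> h t = k" "y \<in> J"
  shows "d = 0"
proof -
  have "(h has_real_derivative 0) (at y)"
    by (rule has_field_derivative_transform_within_open[where f = "\<lambda>_. k", OF DERIV_const J(1) assms(3)])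
      (use assms(2) in auto)
  then show ?thesis using assms(1) DERIV_unique by blast
qed

text \<open>For constant \<open>u''\<close> flatness is affine in \<open>u'\<close>, so both
  coefficients vanish. They give a cubic equation for \<open>v'\<close> with constant coefficients,
  while \<open>v''\<close> has no zeros. Excluding this case first lets \<open>u''_zero\<close>
  reject every argument that ends with \<open>u''\<close> constant.\<close>

lemma u''_not_nonzero_const:
  assumes const: "\<And>x. x \<in> I \<Longrightarrow> u'' x = m" and "m \<noteq> 0"
  shows False
proof -
  have inf: "infinite (u' ` I)"
    using infinite_range_u' I(3) assms by blast
  have split: "v' y * (v'' y - m) = 0 \<and> m * v'' y = 1 + (v' y)\<^sup>2" if y: "y \<in> J" for y
  proof -
    have "m * v'' y - 1 - (v' y)\<^sup>2 + y * (v' y * (v'' y - m)) + v' y * (v'' y - m) * w + 0 * w\<^sup>2 = 0"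
      if "w \<in> u' ` I" for w
      using that flat_eq[OF _ y] const by (auto simp: algebra_simps)
    from quadratic_zero_on_infinite[OF inf this]
    show ?thesis by auto
  qed
  have v''_nz: "v'' y \<noteq> 0" if "y \<in> J" for y
  proof -
    have "1 + (v' y)\<^sup>2 > 0" by (simp add: add_pos_nonneg)
    then show ?thesis using split[OF that] by auto
  qed
  have cubic: "v' y * ((v' y)\<^sup>2 - m\<^sup>2 + 1) = 0" if "y \<in> J" for y
    using split[OF that] by (auto simp: power2_eq_square)
  \<comment> \<open>Differentiating the cubic and dividing by \<open>v''\<close> gives 3 v'^2 = m^2
    - 1, whereas the cubic itself gives v' = 0 or v'^2 = m^2 - 1. Either way v' = 0.\<close>
  have "v' y = 0" if y: "y \<in> J" for y
  proof -
    have "((\<lambda>y. v' y * ((v' y)\<^sup>2 - m\<^sup>2 + 1)) has_real_derivative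
        v'' y * ((v' y)\<^sup>2 - m\<^sup>2 + 1) + (2 * v' y * v'' y) * v' y) (at y)"
      by (auto intro!: derivative_eq_intros v y)
    from derivative_of_const_on_J[OF this cubic y]
    have "v'' y * ((v' y)\<^sup>2 - m\<^sup>2 + 1 + 2 * (v' y)\<^sup>2) = 0"
      by (simp add: power2_eq_square algebra_simps)
    then have "(v' y)\<^sup>2 - m\<^sup>2 + 1 + 2 * (v' y)\<^sup>2 = 0"
      using v''_nz[OF y] by simp
    moreover have "v' y = 0 \<or> (v' y)\<^sup>2 - m\<^sup>2 + 1 = 0"
      using cubic[OF y] by simp
    ultimately have "v' y = 0 \<or> (v' y)\<^sup>2 = 0" by linarith
    then show ?thesis by simp
  qed
  moreover obtain y where "y \<in> J" using J(3) by blast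
  ultimately show False
    using derivative_of_const_on_J[OF v(2)] v''_nz by blast
qed

lemma u''_zero:
  assumes "x \<in> I"
  shows "u'' x = 0"
proof (rule ccontr)
  assume nz: "u'' x \<noteq> 0"
  have not_const: "\<exists>x\<in>I. u'' x \<noteq> m" for m
    using u''_not_nonzero_const[of m] nz assms by metis
  have inf: "infinite (u' ` I)"
    using infinite_range_u' assms nz by blast
  \<comment> \<open>At a zero of \<open>v'\<close> flatness reads u'' v'' = 1 for every
    \<open>x\<close>, which would make \<open>u''\<close> constant.\<close>
  have v'_nz: "v' y \<noteq> 0" if "y \<in> J" for y
  proof
    assume "v' y = 0"
    then have "u'' x * v'' y = 1" if "x \<in> I" for x
      using flat_eq[OF that \<open>y \<in> J\<close>] by simp
    then have "u'' x = 1 / v'' y" if "x \<in> I" for x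
      using that by (metis nonzero_eq_divide_eq mult_zero_right zero_neq_one)
    then show False using not_const by blast
  qed
  \<comment> \<open>Dividing the flatness equation by \<open>v' y\<close> leaves \<open>u'' (A - u') = B - v'' u'\<close>, where only
    \<open>A\<close>, \<open>B\<close> and \<open>v''\<close> depend on \<open>y\<close>.\<close>
  define A where "A y = v'' y / v' y - y" for y
  define B where "B y = (1 + (v' y)\<^sup>2) / v' y - y * v'' y" for y
  have AB: "u'' x * (A y - u' x) = B y - v'' y * u' x" if "x \<in> I" "y \<in> J" for x y
    using flat_eq[OF that] v'_nz[OF that(2)]
    by (simp add: A_def B_def field_simps power2_eq_square)
  have A_const: "A y = A z \<and> v'' y = v'' z" if "y \<in> J" "z \<in> J" for y z
  proof -
    \<comment> \<open>Subtracting the equations at \<open>y\<close> and \<open>z\<close> gives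
      \<alpha> u'' = \<beta> - \<delta> u'. Substituting into \<alpha> times the equation at
      \<open>y\<close> eliminates \<open>u''\<close> and leaves a quadratic in \<open>u'\<close>
      with leading coefficient \<delta>. Once \<delta> = 0, a nonzero \<alpha> would make
      \<open>u''\<close> constant.\<close>
    define \<alpha> \<beta> \<delta> where "\<alpha> = A y - A z" and "\<beta> = B y - B z" and "\<delta> = v'' y - v'' z"
    have diff: "\<alpha> * u'' x = \<beta> - \<delta> * u' x" if "x \<in> I" for x
      using AB[OF that \<open>y \<in> J\<close>] AB[OF that \<open>z \<in> J\<close>] by (simp add: \<alpha>_def \<beta>_def \<delta>_def algebra_simps)
    have "(\<beta> - \<delta> * u' x) * (A y - u' x) = \<alpha> * (B y - v'' y * u' x)" if "x \<in> I" for x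
      using AB[OF that \<open>y \<in> J\<close>] diff[OF that] by (metis mult.assoc)
    then have "\<beta> * A y - \<alpha> * B y + (\<alpha> * v'' y - \<beta> - \<delta> * A y) * w + \<delta> * w\<^sup>2 = 0" if "w \<in> u' ` I" for w
      using that by (auto simp: power2_eq_square algebra_simps)
    then have "\<delta> = 0"
      using quadratic_zero_on_infinite[OF inf] by blast
    then have "u'' x = \<beta> / \<alpha>" if "x \<in> I" "\<alpha> \<noteq> 0" for x
      using diff[OF that(1)] that(2) by (simp add: field_simps)
    then have "\<alpha> = 0" using not_const by blast
    with \<open>\<delta> = 0\<close> show ?thesis by (simp add: \<alpha>_def \<delta>_def)
  qed
  obtain y where y: "y \<in> J" using J(3) by blast
  \<comment> \<open>Constancy of \<open>A\<close> says v'' = v' (a + t), and \<open>v''\<close> is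
    constant as well. Differentiating this product and substituting for \<open>v''\<close> gives v'
    (1 + (a + y)^2) = 0, which is impossible.\<close>
  define a where "a = A y"
  have vv: "v'' t = v' t * (a + t)" if "t \<in> J" for t
    using A_const[OF that y] v'_nz[OF that] by (auto simp: a_def A_def field_simps)
  have "((\<lambda>t. v' t * (a + t)) has_real_derivative v'' y * (a + y) + v' y) (at y)"
    by (auto intro!: derivative_eq_intros v y)
  moreover have "v' t * (a + t) = v'' y" if "t \<in> J" for t
    using vv[OF that] A_const[OF that y] by simp
  ultimately have "v'' y * (a + y) + v' y = 0"
    using derivative_of_const_on_J y by blast
  then have "v' y * (1 + (a + y)\<^sup>2) = 0"
    using vv[OF y] by (simp add: power2_eq_square algebra_simps)
  moreover have "1 + (a + y)\<^sup>2 > 0" by (simp add: add_pos_nonneg)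
  ultimately show False using v'_nz[OF y] by auto
qed

text \<open>The strict inequality records that \<open>v'\<close> has no zeros; it keeps the square
  root differentiable when the primitive is taken.\<close>

lemma v'_eq:
  obtains A C e where "C > 0" "e \<in> {1, -1}" "\<And>x. x \<in> I \<Longrightarrow> u' x = A"
    "\<And>y. y \<in> J \<Longrightarrow> C * (A + y)\<^sup>2 > 1 \<and> v' y = e * sqrt (C * (A + y)\<^sup>2 - 1)"
proof -
  have "\<exists>A. \<forall>x\<in>I. u' x = A"
    using u(2) u''_zero I(2)
    by (intro has_field_derivative_zero_constant) (auto simp: is_interval_convex intro: has_field_derivative_at_within)
  then obtain A where A: "\<And>x. x \<in> I \<Longrightarrow> u' x = A" by blast
  obtain x0 where x0: "x0 \<in> I" using I(3) by blast
  have ode: "(A + y) * v' y * v'' y = 1 + (v' y)\<^sup>2" if "y \<in> J" for y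
    using flat_eq[OF x0 that] A[OF x0] u''_zero[OF x0] by (simp add: algebra_simps)
  have pos: "1 + (v' y)\<^sup>2 > 0" for y by (simp add: add_pos_nonneg)
  have nz: "A + y \<noteq> 0" "v' y \<noteq> 0" if "y \<in> J" for y
    using ode[OF that] pos[of y] by auto
  \<comment> \<open>Separating variables gives v' v'' / (1 + v'^2) = 1 / (A + y), whose integration
    suggests this quotient as a conserved quantity.\<close>
  have "((\<lambda>y. (1 + (v' y)\<^sup>2) / (A + y)\<^sup>2) has_real_derivative 0) (at y)" if y: "y \<in> J" for y
  proof -
    have "((\<lambda>y. (1 + (v' y)\<^sup>2) / (A + y)\<^sup>2) has_real_derivative
        (2 * v' y * v'' y * (A + y)\<^sup>2 - (1 + (v' y)\<^sup>2) * (2 * (A + y))) / ((A + y)\<^sup>2 * (A + y)\<^sup>2)) (at y)"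
      using nz[OF y] by (auto intro!: derivative_eq_intros v y)
    moreover have "2 * v' y * v'' y * (A + y)\<^sup>2 - (1 + (v' y)\<^sup>2) * (2 * (A + y)) = 0"
      unfolding ode[OF y, symmetric] by (simp add: power2_eq_square algebra_simps)
    ultimately show ?thesis by simp
  qed
  then have "\<exists>C. \<forall>y\<in>J. (1 + (v' y)\<^sup>2) / (A + y)\<^sup>2 = C"
    using J(2)
    by (intro has_field_derivative_zero_constant) (auto simp: is_interval_convex intro: has_field_derivative_at_within)
  then obtain C where "\<And>y. y \<in> J \<Longrightarrow> (1 + (v' y)\<^sup>2) / (A + y)\<^sup>2 = C" by blast
  then have C: "1 + (v' y)\<^sup>2 = C * (A + y)\<^sup>2" if "y \<in> J" for y
    using nz(1)[OF that] that by (metis nonzero_divide_eq_eq power_not_zero)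
  obtain y0 where y0: "y0 \<in> J" using J(3) by blast
  have "C > 0"
    using C[OF y0] pos[of y0] by (metis zero_less_mult_pos2 nz(1)[OF y0] zero_less_power2)
  have "continuous_on J v'"
    using v(2) DERIV_continuous_on has_field_derivative_at_within by blast
  then have conn: "is_interval (v' ` J)"
    using J(2) connected_continuous_image by (auto simp: is_interval_connected_1)
  define e where "e = sgn (v' y0)"
  have e: "e \<in> {1, -1}" using nz(2)[OF y0] by (auto simp: e_def sgn_if)
  \<comment> \<open>A change of sign on the interval \<open>J\<close> would force a zero of
    \<open>v'\<close> by the intermediate value property.\<close>
  have sgn: "sgn (v' y) = e" if "y \<in> J" for y
  proof (rule ccontr)
    assume "sgn (v' y) \<noteq> e"
    then have "v' y \<le> 0 \<and> 0 \<le> v' y0 \<or> v' y0 \<le> 0 \<and> 0 \<le> v' y"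
      by (auto simp: e_def sgn_if split: if_splits)
    then have "0 \<in> v' ` J"
      using conn y0 that unfolding is_interval_1 by blast
    then show False using nz(2) by auto
  qed
  have "C * (A + y)\<^sup>2 > 1 \<and> v' y = e * sqrt (C * (A + y)\<^sup>2 - 1)" if y: "y \<in> J" for y
  proof -
    have sq: "C * (A + y)\<^sup>2 - 1 = (v' y)\<^sup>2" using C[OF y] by simp
    have "v' y = e * sqrt ((v' y)\<^sup>2)" using sgn[OF y] by (metis real_sqrt_abs sgn_mult_abs)
    moreover have "(v' y)\<^sup>2 > 0" using nz(2)[OF y] by simp
    ultimately show ?thesis unfolding sq[symmetric] by linarith
  qed
  with \<open>C > 0\<close> e A show ?thesis using that by blast
qed

text \<open>\<open>u\<close> and \<open>v\<close> are each recovered from their derivatives up to a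
  constant; the two constants add up to the vertical translation \<open>c\<close>.\<close>

lemma f_eq:
  "\<exists>A C c e. C > 0 \<and> e \<in> {1, -1} \<and> (\<forall>y\<in>J. C * (A + y)\<^sup>2 \<ge> 1) \<and>
    (\<forall>x\<in>I. \<forall>y\<in>J. f (x, y) + c = x * y / 2 + A * x
      + (A + y) * (e * sqrt (C * (A + y)\<^sup>2 - 1)) / 2
      + ln \<bar>e * sqrt (C * (A + y)\<^sup>2 - 1) - sqrt C * (A + y)\<bar> / (2 * sqrt C))"
proof -
  obtain A C e where C: "C > 0" and e: "e \<in> {1, -1}" and A: "\<And>x. x \<in> I \<Longrightarrow> u' x = A"
    and v': "\<And>y. y \<in> J \<Longrightarrow> C * (A + y)\<^sup>2 > 1 \<and> v' y = e * sqrt (C * (A + y)\<^sup>2 - 1)"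
    by (rule v'_eq) (rule that; assumption)
  define F where "F y = (A + y) * (e * sqrt (C * (A + y)\<^sup>2 - 1)) / 2
      + ln \<bar>e * sqrt (C * (A + y)\<^sup>2 - 1) - sqrt C * (A + y)\<bar> / (2 * sqrt C)" for y
  have "((\<lambda>x. A * x - u x) has_real_derivative 0) (at x)" if "x \<in> I" for x
    using A[OF that] by (auto intro!: derivative_eq_intros u that)
  then have "\<exists>c. \<forall>x\<in>I. A * x - u x = c"
    using I(2)
    by (intro has_field_derivative_zero_constant) (auto simp: is_interval_convex intro: has_field_derivative_at_within)
  then obtain c where c: "\<forall>x\<in>I. A * x - u x = c" by blast
  have "((\<lambda>y. F y - v y) has_real_derivative 0) (at y)" if "y \<in> J" for y
  proof -
    have "(F has_real_derivative v' y) (at y)"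
      unfolding F_def conjunct2[OF v'[OF that]]
      by (rule has_real_derivative_translation_primitive[OF C e conjunct1[OF v'[OF that]]])
    then show ?thesis by (auto intro!: derivative_eq_intros v that)
  qed
  then have "\<exists>d. \<forall>y\<in>J. F y - v y = d"
    using J(2)
    by (intro has_field_derivative_zero_constant) (auto simp: is_interval_convex intro: has_field_derivative_at_within)
  then obtain d where d: "\<forall>y\<in>J. F y - v y = d" by blast
  have "\<forall>x\<in>I. \<forall>y\<in>J. f (x, y) + (c + d) = x * y / 2 + A * x
      + (A + y) * (e * sqrt (C * (A + y)\<^sup>2 - 1)) / 2
      + ln \<bar>e * sqrt (C * (A + y)\<^sup>2 - 1) - sqrt C * (A + y)\<bar> / (2 * sqrt C)"
  proof (intro ballI)
    fix x y assume xy: "x \<in> I" "y \<in> J"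
    have "f (x, y) + (c + d) = x * y / 2 + A * x + F y"
      using bspec[OF c xy(1)] bspec[OF d xy(2)] unfolding f by linarith
    then show "f (x, y) + (c + d) = x * y / 2 + A * x
      + (A + y) * (e * sqrt (C * (A + y)\<^sup>2 - 1)) / 2
      + ln \<bar>e * sqrt (C * (A + y)\<^sup>2 - 1) - sqrt C * (A + y)\<bar> / (2 * sqrt C)"
      by (simp only: F_def add.assoc)
  qed
  moreover have "\<forall>y\<in>J. C * (A + y)\<^sup>2 \<ge> 1"
    using v' less_imp_le by blast
  ultimately show ?thesis
    using C e by blast
qed

end

text \<open>Flatness fixes only the square of \<open>v'\<close>, so \<epsilon> selects the branch of
  the root. Since the conjugate arguments of the logarithm multiply to -1, passing from \<epsilon> =
  1 to \<epsilon> = -1 negates the sum of the root term and the logarithmic term.\<close>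

theorem theorem5:
  fixes I J :: "real set" and u v :: "real \<Rightarrow> real"
    and \<gamma>\<^sub>1 \<gamma>\<^sub>2 :: "real \<Rightarrow> point3" and f :: "real \<times> real \<Rightarrow> real"
  assumes "open I" "is_interval I" "I \<noteq> {}"
    and "open J" "is_interval J" "J \<noteq> {}"
    and "smooth_curve_on I u" "smooth_curve_on J v"
    and "\<And>x. \<gamma>\<^sub>1 x = (x, 0, u x)" "\<And>y. \<gamma>\<^sub>2 y = (0, y, v y)"
    and "\<And>x y. f (x, y) = x * y / 2 + u x + v y"
  shows "nonparametric_surface (translation_surface \<gamma>\<^sub>1 I \<gamma>\<^sub>2 J) (I \<times> J) f \<and>
    (flat_graph (I \<times> J) f \<longrightarrow>
      (\<forall>z\<in>I \<times> J. gauss_map_det f z = 0) \<and>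
      (\<exists>A C c \<epsilon> :: real. C > 0 \<and> \<epsilon> \<in> {1, -1} \<and> (\<forall>y\<in>J. C * (A + y)\<^sup>2 \<ge> 1) \<and>
        (\<forall>x\<in>I. \<forall>y\<in>J. f (x, y) + c =
          x * y / 2 + A * x
          + (A + y) * (\<epsilon> * sqrt (C * (A + y)\<^sup>2 - 1)) / 2
          + ln \<bar>\<epsilon> * sqrt (C * (A + y)\<^sup>2 - 1) - sqrt C * (A + y)\<bar> / (2 * sqrt C))))"
proof (intro conjI impI)
  note I = assms(1-3) and J = assms(4-6) and u = assms(7) and v = assms(8)
    and \<gamma> = assms(9,10) and f = assms(11)
  have "heis_mult (\<gamma>\<^sub>1 x) (\<gamma>\<^sub>2 y) = graph_point f (x, y)" for x y
    by (simp add: \<gamma> f graph_point_def)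
  then have "translation_surface \<gamma>\<^sub>1 I \<gamma>\<^sub>2 J = graph_point f ` (I \<times> J)"
    unfolding translation_surface_def by auto
  moreover have "smooth_plane_on (I \<times> J) f"
    by (rule smooth_plane_on_translation_graph[OF I(1) J(1) u v, of f "1 / 2"]) (simp add: f)
  ultimately show "nonparametric_surface (translation_surface \<gamma>\<^sub>1 I \<gamma>\<^sub>2 J) (I \<times> J) f"
    unfolding nonparametric_surface_def using I J by (simp add: open_Times)
  assume "flat_graph (I \<times> J) f"
  \<comment> \<open>\<open>deriv\<close> is total; smoothness on the open intervals makes it the
    actual derivative there, which is all that the locale asks for.\<close>
  then interpret flat_translation_graph I J u "deriv u" "deriv (deriv u)" v "deriv v" "deriv (deriv v)" f
    using I J u v f
    by unfold_locales (auto intro: smooth_curve_on_has_derivative smooth_curve_on_deriv)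
  show "\<forall>z\<in>I \<times> J. gauss_map_det f z = 0"
    using gauss_map_det_eq u''_zero by auto
  show "\<exists>A C c \<epsilon> :: real. C > 0 \<and> \<epsilon> \<in> {1, -1} \<and> (\<forall>y\<in>J. C * (A + y)\<^sup>2 \<ge> 1) \<and>
        (\<forall>x\<in>I. \<forall>y\<in>J. f (x, y) + c =
          x * y / 2 + A * x
          + (A + y) * (\<epsilon> * sqrt (C * (A + y)\<^sup>2 - 1)) / 2
          + ln \<bar>\<epsilon> * sqrt (C * (A + y)\<^sup>2 - 1) - sqrt C * (A + y)\<bar> / (2 * sqrt C))"
    by (rule f_eq)
qed

end
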